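(* Let $A\subset\mathbb{R}^n$ be a closed set and let $y\in\partial A$. If there exists $c>0$ such that $\gamma_1\cdot\gamma_2>c$ for all $\gamma_1,\gamma_2\in\partial^>d_A(y)$, then $\mathrm{int}\,T_A(y)\ne\emptyset$.
   Context: $d_A(y)=\inf_{x\in A}|x-y|$ is the Euclidean distance function, $\partial A$ the boundary, $\mathrm{int}$ the interior, $\mathrm{co}$ the convex hull. Hybrid subdifferential of a function $h$ Lipschitz near $\bar x$: $\partial^>h(\bar x)=\mathrm{co}\{\gamma\in\mathbb{R}^n:\exists x_i\to\bar x$ with $h(x_i)\to h(\bar x)$, $h(x_i)>0$ for all $i$, and $\nabla h(x_i)\to\gamma\}$ (it being understood that $h$ is differentiable at each $x_i$). Clarke tangent cone at $\bar x\in A$: $T_A(\bar x)=\{\xi\in\mathbb{R}^n:$ for all sequences $x_i\to\bar x$ with $x_i\in A$ and all $t_i\downarrow0$ there exist $a_i\in A$ with $t_i^{-1}(a_i-x_i)\to\xi\}$. *)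

theory Defs
  imports "HOL-Analysis.Analysis"
begin

text \<open>The distance function of a nonempty set \<open>A\<close> is \<open>\<lambda>x. infdist x A\<close>.\<close>

definition hybrid_subdiff :: "(real^'n \<Rightarrow> real) \<Rightarrow> real^'n \<Rightarrow> (real^'n) set" where
  "hybrid_subdiff h z = convex hull {\<gamma>. \<exists>x g.
      x \<longlonglongrightarrow> z \<and> (\<lambda>i. h (x i)) \<longlonglongrightarrow> h z \<and> (\<forall>i::nat. h (x i) > 0) \<and>
      (\<forall>i. GDERIV h (x i) :> g i) \<and> g \<longlonglongrightarrow> \<gamma>}"

text \<open>
  The convergence of \<open>t\<close> to zero from above is read as: \<open>t\<close> is positive and tends to \<open>0\<close>.
  Requiring \<open>t\<close> to be monotone in addition gives the same cone, by passing to subsequences.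
\<close>

definition clarke_tangent_cone :: "(real^'n) set \<Rightarrow> real^'n \<Rightarrow> (real^'n) set" where
  "clarke_tangent_cone A z = {\<xi>. \<forall>x t.
      x \<longlonglongrightarrow> z \<and> (\<forall>i::nat. x i \<in> A) \<and> (\<forall>i::nat. t i > 0) \<and> t \<longlonglongrightarrow> 0 \<longrightarrow>
      (\<exists>a. (\<forall>i. a i \<in> A) \<and> (\<lambda>i. inverse (t i) *\<^sub>R (a i - x i)) \<longlonglongrightarrow> \<xi>)}"

end

theory Submission
  imports Defs
begin

text \<open>
  If \<open>p\<close> is a point of \<open>A\<close> nearest to \<open>x \<notin> A\<close>, then \<open>d\<^sub>A\<close> is differentiable at the midpoint of \<open>x\<close>
  and \<open>p\<close> with gradient \<open>(x - p) / |x - p|\<close>, being squeezed there between \<open>w \<mapsto> d\<^sub>A x - |x - w|\<close>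
  and \<open>w \<mapsto> |w - p|\<close>. Hence cluster points of such unit vectors, as \<open>x \<rightarrow> y\<close>, lie in the hybrid
  subdifferential. Fix one of them, \<open>\<gamma>\<^sub>0\<close>. By compactness, every \<open>u\<close> close to \<open>-\<gamma>\<^sub>0\<close> makes a negative
  inner product with all the unit vectors for \<open>x\<close> near \<open>y\<close>, so \<open>d\<^sub>A\<close> decreases in direction \<open>u\<close> at
  points near \<open>y\<close> outside \<open>A\<close>. A ray in direction \<open>u\<close> starting in \<open>A\<close> near \<open>y\<close> therefore cannot leave
  \<open>A\<close> for a while, and this gives \<open>u \<in> T\<^sub>A(y)\<close>.
\<close>

section \<open>Differentiability of the distance at midpoints\<close>

text \<open>Since the three functions agree at \<open>z\<close>, the remainder of \<open>f\<close>
  lies between those of \<open>l\<close> and \<open>g\<close>, so its norm is at most the sum of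
  their norms.\<close>

lemma has_derivative_squeeze:
  fixes f l g :: "'a::real_normed_vector \<Rightarrow> real"
  assumes l: "(l has_derivative D) (at z)" and g: "(g has_derivative D) (at z)"
    and lf: "\<And>w. l w \<le> f w" and fg: "\<And>w. f w \<le> g w" and eq: "l z = f z" "g z = f z"
  shows "(f has_derivative D) (at z)"
proof -
  have lim: "((\<lambda>w. norm (l w - l z - D (w - z)) / norm (w - z)
                  + norm (g w - g z - D (w - z)) / norm (w - z)) \<longlongrightarrow> 0) (at z)"
    using l g by (intro tendsto_add_zero) (auto simp: has_derivative_iff_norm)
  have "norm (f w - f z - D (w - z)) / norm (w - z)
      \<le> norm (l w - l z - D (w - z)) / norm (w - z) + norm (g w - g z - D (w - z)) / norm (w - z)" for w
  proof -
    have "norm (f w - f z - D (w - z)) \<le> norm (l w - l z - D (w - z)) + norm (g w - g z - D (w - z))"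
      using lf[of w] fg[of w] eq by (simp add: abs_if)
    then show ?thesis
      by (simp add: divide_right_mono flip: add_divide_distrib)
  qed
  then have "((\<lambda>w. norm (f w - f z - D (w - z)) / norm (w - z)) \<longlongrightarrow> 0) (at z)"
    by (intro tendsto_sandwich[OF _ _ tendsto_const lim] always_eventually) auto
  then show ?thesis
    using l by (simp add: has_derivative_iff_norm)
qed

lemma has_derivative_norm_diff:
  fixes z p :: "'a::real_inner"
  assumes "z \<noteq> p"
  shows "((\<lambda>w. norm (w - p)) has_derivative (\<lambda>h. h \<bullet> sgn (z - p))) (at z)"
proof -
  have "(norm has_derivative (\<lambda>h. h \<bullet> sgn (z - p))) (at (z - p))"
    using GDERIV_norm[of "z - p"] assms by (simp add: gderiv_def)
  moreover have "((\<lambda>w. w - p) has_derivative (\<lambda>h. h)) (at z)"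
    by (auto intro!: derivative_eq_intros)
  ultimately show ?thesis
    by (rule has_derivative_compose[rotated])
qed

text \<open>The point \<open>x\<close> may have several nearest points in \<open>A\<close>, and then
  the distance need not be differentiable there. The midpoint differs from both \<open>x\<close> and
  \<open>p\<close>, so both bounding functions are smooth at it.\<close>

lemma
  fixes x p :: "'a::real_inner"
  assumes p: "p \<in> A" and near: "dist x p = infdist x A" and ne: "x \<noteq> p"
  shows infdist_midpoint_nearest: "infdist (midpoint x p) A = dist x p / 2"
    and GDERIV_infdist_midpoint_nearest: "GDERIV (\<lambda>w. infdist w A) (midpoint x p) :> sgn (x - p)"
proof -
  define z where "z = midpoint x p"
  have dz: "dist z p = dist x p / 2" "dist x z = dist x p / 2"
    by (simp_all add: z_def dist_midpoint)
  have lower: "infdist x A - norm (w - x) \<le> infdist w A" for w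
    using infdist_triangle[of x A w] by (simp add: dist_norm norm_minus_commute)
  have upper: "infdist w A \<le> norm (w - p)" for w
    using infdist_le[OF p, of w] by (simp add: dist_norm)
  \<comment> \<open>At \<open>z\<close> the lower and the upper bound take the same value
    \<open>dist x p / 2\<close>.\<close>
  show iz: "infdist (midpoint x p) A = dist x p / 2"
    using lower[of z] upper[of z] dz near by (simp add: dist_norm norm_minus_commute flip: z_def)
  have zp: "z - p = (1/2) *\<^sub>R (x - p)"
    by (simp add: z_def midpoint_def algebra_simps flip: scaleR_add_left)
  have zx: "z - x = (-1/2) *\<^sub>R (x - p)"
    by (simp add: z_def midpoint_def algebra_simps flip: scaleR_add_left)
  have sg: "sgn (z - p) = sgn (x - p)" "sgn (z - x) = - sgn (x - p)"
    unfolding zp zx by (simp_all only: sgn_scaleR) (simp_all add: sgn_real_def)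
  have "z \<noteq> p" "z \<noteq> x"
    using ne dz by auto
  then have g: "((\<lambda>w. norm (w - p)) has_derivative (\<lambda>h. h \<bullet> sgn (x - p))) (at z)"
    and n: "((\<lambda>w. norm (w - x)) has_derivative (\<lambda>h. - (h \<bullet> sgn (x - p)))) (at z)"
    using has_derivative_norm_diff[of z p] has_derivative_norm_diff[of z x] by (simp_all add: sg)
  have l: "((\<lambda>w. infdist x A - norm (w - x)) has_derivative (\<lambda>h. h \<bullet> sgn (x - p))) (at z)"
    using has_derivative_diff[OF has_derivative_const n] by simp
  show "GDERIV (\<lambda>w. infdist w A) (midpoint x p) :> sgn (x - p)"
    unfolding gderiv_def z_def[symmetric]
    using iz dz near
    by (intro has_derivative_squeeze[OF l g lower upper])
       (simp_all add: dist_norm norm_minus_commute flip: z_def)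
qed

section \<open>Limits of nearest-point directions\<close>

text \<open>Compactness of the unit ball gives the convergent subsequence. The midpoints witness
  membership of its limit: they tend to \<open>y\<close>, have positive distance to
  \<open>A\<close>, and carry the directions as gradients.\<close>

lemma nearest_direction_cluster:
  fixes A :: "(real^'n) set"
  assumes y: "y \<in> A" and x: "x \<longlonglongrightarrow> y" and p: "\<And>k::nat. p k \<in> A"
    and near: "\<And>k. dist (x k) (p k) = infdist (x k) A" and ne: "\<And>k. x k \<noteq> p k"
  obtains \<gamma> r where "\<gamma> \<in> hybrid_subdiff (\<lambda>w. infdist w A) y" "norm \<gamma> = 1" "strict_mono r"
    "(\<lambda>k. sgn (x (r k) - p (r k))) \<longlonglongrightarrow> \<gamma>"
proof -
  have "\<forall>k. sgn (x k - p k) \<in> cball 0 1"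
    by (simp add: norm_sgn)
  then obtain \<gamma> r where r: "strict_mono r" "((\<lambda>k. sgn (x k - p k)) \<circ> r) \<longlonglongrightarrow> \<gamma>"
    using compact_cball[of "0::real^'n" 1] unfolding compact_def by meson
  define z where "z k = midpoint (x (r k)) (p (r k))" for k
  have xr: "(\<lambda>k. x (r k)) \<longlonglongrightarrow> y"
    using LIMSEQ_subseq_LIMSEQ[OF x r(1)] by (simp add: o_def)
  have lim: "(\<lambda>k. dist (x (r k)) y + dist (x (r k)) y) \<longlonglongrightarrow> 0"
    using xr by (intro tendsto_add_zero tendsto_dist_iff[THEN iffD1])
  \<comment> \<open>As \<open>y\<close> lies in \<open>A\<close>, the nearest point is no farther
    from \<open>x (r k)\<close> than \<open>y\<close> is; the midpoint is at most half that
    far.\<close>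
  have bound: "dist (z k) y \<le> dist (x (r k)) y + dist (x (r k)) y" for k
  proof -
    have "dist (x (r k)) (p (r k)) \<le> dist (x (r k)) y"
      unfolding near by (rule infdist_le[OF y])
    moreover have "dist (x (r k)) (z k) = dist (x (r k)) (p (r k)) / 2"
      by (simp add: z_def dist_midpoint)
    ultimately show ?thesis
      using dist_triangle3[of "z k" y "x (r k)"] zero_le_dist[of "x (r k)" y] by linarith
  qed
  have "(\<lambda>k. dist (z k) y) \<longlonglongrightarrow> 0"
    by (rule tendsto_sandwich[OF _ _ tendsto_const lim]) (intro always_eventually allI zero_le_dist bound)+
  then have zy: "z \<longlonglongrightarrow> y"
    by (rule tendsto_dist_iff[THEN iffD2])
  have "(\<lambda>k. infdist (z k) A) \<longlonglongrightarrow> infdist y A"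
    using zy by (rule tendsto_infdist)
  moreover have "infdist (z k) A > 0" for k
    unfolding z_def infdist_midpoint_nearest[OF p near ne] using ne by simp
  moreover have "GDERIV (\<lambda>w. infdist w A) (z k) :> sgn (x (r k) - p (r k))" for k
    unfolding z_def by (rule GDERIV_infdist_midpoint_nearest[OF p near ne])
  ultimately have "\<gamma> \<in> hybrid_subdiff (\<lambda>w. infdist w A) y"
    unfolding hybrid_subdiff_def using zy r(2)
    by (intro hull_inc CollectI exI[of _ z] exI[of _ "\<lambda>k. sgn (x (r k) - p (r k))"])
       (auto simp: o_def)
  moreover have "norm \<gamma> = 1"
    using tendsto_norm[OF r(2)] ne by (simp add: o_def norm_sgn LIMSEQ_const_iff)
  ultimately show ?thesis
    using that r by (auto simp: o_def)
qed

text \<open>Excludes that the inner product condition of the theorem holds vacuously. A frontier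
  point is a limit of points outside \<open>A\<close>, and their nearest-point directions have a
  cluster point.\<close>

lemma hybrid_subdiff_infdist_nonempty:
  fixes A :: "(real^'n) set"
  assumes A: "closed A" and y: "y \<in> frontier A"
  shows "hybrid_subdiff (\<lambda>w. infdist w A) y \<noteq> {}"
proof -
  have yA: "y \<in> A"
    using A y by (simp add: frontier_def)
  have "y \<in> closure (- A)"
    using y by (simp add: frontier_closures)
  then obtain x where x: "\<And>k::nat. x k \<notin> A" "x \<longlonglongrightarrow> y"
    unfolding closure_sequential by auto
  have "\<exists>p\<in>A. infdist (x k) A = dist (x k) p" for k
    using infdist_attains_inf[OF A, of "x k"] yA by (metis empty_iff)
  then obtain p where p: "\<And>k. p k \<in> A" "\<And>k. infdist (x k) A = dist (x k) (p k)"
    by metis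
  have "x k \<noteq> p k" for k
    using x(1) p(1) by metis
  then show ?thesis
    using nearest_direction_cluster[OF yA x(2) p(1) p(2)[symmetric]] by blast
qed

text \<open>Otherwise offending directions at points tending to \<open>y\<close> would cluster at a
  unit vector of the hybrid subdifferential whose inner product with \<open>u\<close> is
  nonnegative.\<close>

lemma nearest_direction_inner_neg:
  fixes A :: "(real^'n) set"
  assumes y: "y \<in> A" and neg: "\<And>\<gamma>. \<gamma> \<in> hybrid_subdiff (\<lambda>w. infdist w A) y \<Longrightarrow> norm \<gamma> = 1 \<Longrightarrow> \<gamma> \<bullet> u < 0"
  shows "\<exists>\<delta>>0. \<forall>x p. dist x y < \<delta> \<longrightarrow> x \<noteq> p \<longrightarrow> p \<in> A \<longrightarrow> dist x p = infdist x A
           \<longrightarrow> sgn (x - p) \<bullet> u < 0"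
proof (rule ccontr)
  assume "\<not> ?thesis"
  then have "\<exists>x p. dist x y < inverse (real (Suc k)) \<and> x \<noteq> p \<and> p \<in> A \<and> dist x p = infdist x A
       \<and> \<not> sgn (x - p) \<bullet> u < 0" for k :: nat
    by (metis inverse_positive_iff_positive of_nat_0_less_iff zero_less_Suc)
  then obtain x p where xp: "\<And>k::nat. dist (x k) y < inverse (real (Suc k))" "\<And>k. x k \<noteq> p k"
      "\<And>k. p k \<in> A" "\<And>k. dist (x k) (p k) = infdist (x k) A" "\<And>k. sgn (x k - p k) \<bullet> u \<ge> 0"
    unfolding not_less by metis
  have "(\<lambda>k. dist (x k) y) \<longlonglongrightarrow> 0"
    by (rule tendsto_sandwich[OF _ _ tendsto_const LIMSEQ_inverse_real_of_nat])
       (use xp(1) in \<open>auto intro!: always_eventually less_imp_le simp del: of_nat_Suc\<close>)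
  then have "x \<longlonglongrightarrow> y"
    by (rule tendsto_dist_iff[THEN iffD2])
  then obtain \<gamma> r where g: "\<gamma> \<in> hybrid_subdiff (\<lambda>w. infdist w A) y" "norm \<gamma> = 1"
      "(\<lambda>k. sgn (x (r k) - p (r k))) \<longlonglongrightarrow> \<gamma>"
    by (rule nearest_direction_cluster[OF y _ xp(3,4,2)])
  have "(\<lambda>k. sgn (x (r k) - p (r k)) \<bullet> u) \<longlonglongrightarrow> \<gamma> \<bullet> u"
    using g(3) by (intro tendsto_inner) auto
  then have "\<gamma> \<bullet> u \<ge> 0"
    using xp(5) by (intro LIMSEQ_le_const) blast+
  with neg[OF g(1,2)] show False
    by simp
qed

section \<open>Decrease of the distance along a ray\<close>

text \<open>The distance itself may fail to be differentiable at \<open>z\<close>, but the distance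
  to the fixed point \<open>p\<close> majorizes it, agrees with it at \<open>z\<close>, and has the
  negative derivative \<open>sgn (z - p) \<bullet> u\<close> in direction \<open>u\<close>.\<close>

lemma nearest_direction_decrease:
  fixes u z p :: "'a::real_inner"
  assumes "sgn (z - p) \<bullet> u < 0" and "p \<in> A" and "dist z p = infdist z A"
  shows "\<exists>e>0. \<forall>s>0. s < e \<longrightarrow> infdist (z + s *\<^sub>R u) A < infdist z A"
proof -
  have "z \<noteq> p"
    using assms(1) by auto
  \<comment> \<open>The base point is written as the value of \<open>z + s *\<^sub>R u\<close> at
    \<open>s = 0\<close> to fit the chain rule.\<close>
  then have "((\<lambda>w. norm (w - p)) has_derivative (\<lambda>h. h \<bullet> sgn (z - p))) (at (z + 0 *\<^sub>R u))"
    using has_derivative_norm_diff by simp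
  moreover have "((\<lambda>s. z + s *\<^sub>R u) has_derivative (\<lambda>s. s *\<^sub>R u)) (at 0)"
    by (auto intro!: derivative_eq_intros)
  ultimately have "((\<lambda>s. norm (z + s *\<^sub>R u - p)) has_derivative (\<lambda>s. (s *\<^sub>R u) \<bullet> sgn (z - p))) (at 0)"
    by (rule has_derivative_compose[rotated])
  then have "((\<lambda>s. norm (z + s *\<^sub>R u - p)) has_real_derivative (sgn (z - p) \<bullet> u)) (at 0)"
    by (simp add: has_field_derivative_def mult.commute inner_commute mult_commute_abs)
  from DERIV_neg_dec_right[OF this assms(1)] obtain e where e: "e > 0"
      "\<And>s. s > 0 \<Longrightarrow> s < e \<Longrightarrow> norm (z + s *\<^sub>R u - p) < norm (z - p)"
    by auto
  have "infdist (z + s *\<^sub>R u) A < infdist z A" if "s > 0" "s < e" for s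
    using infdist_le[OF assms(2), of "z + s *\<^sub>R u"] e(2)[OF that] assms(3) by (simp add: dist_norm)
  with e(1) show ?thesis
    by blast
qed

text \<open>
  At the last parameter where the value is at most half of \<open>f T\<close>, either continuity (if the value
  is \<open>0\<close>) or the decrease to the right keeps it that small a little longer.
\<close>

lemma continuous_right_decreasing_eq_0:
  fixes f :: "real \<Rightarrow> real"
  assumes cont: "continuous_on UNIV f" and f0: "f 0 = 0" and T: "T \<ge> 0" and nonneg: "\<And>t. f t \<ge> 0"
    and dec: "\<And>t. 0 \<le> t \<Longrightarrow> t < T \<Longrightarrow> f t > 0 \<Longrightarrow> \<exists>e>0. \<forall>s>0. s < e \<longrightarrow> f (t + s) < f t"
  shows "f T = 0"
proof (rule ccontr)
  assume "f T \<noteq> 0"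
  then have fT: "f T > 0"
    using nonneg[of T] by simp
  define S where "S = {0..T} \<inter> {t. f t \<le> f T / 2}"
  have "compact S"
    unfolding S_def by (intro compact_Int_closed closed_Collect_le cont continuous_on_const) auto
  moreover have "0 \<in> S"
    using T f0 fT by (simp add: S_def)
  ultimately obtain m where m: "m \<in> S" "\<And>t. t \<in> S \<Longrightarrow> t \<le> m"
    using compact_attains_sup[of S] by blast
  have "m \<noteq> T"
    using m(1) fT by (auto simp: S_def)
  then have mT: "0 \<le> m" "m < T" "f m \<le> f T / 2"
    using m(1) by (auto simp: S_def)
  have "\<exists>e>0. \<forall>s>0. s < e \<longrightarrow> f (m + s) \<le> f T / 2"
  proof (cases "f m = 0")
    case True
    obtain e where "e > 0" and close: "\<And>t. dist t m < e \<Longrightarrow> dist (f t) (f m) < f T / 2"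
      using cont fT unfolding continuous_on_iff by (metis UNIV_I half_gt_zero)
    then have "f (m + s) \<le> f T / 2" if "s > 0" "s < e" for s
      using close[of "m + s"] that True nonneg[of "m + s"] by (simp add: dist_real_def)
    with \<open>e > 0\<close> show ?thesis
      by blast
  next
    case False
    then show ?thesis
      using dec[OF mT(1,2)] mT(3) nonneg[of m] by (metis less_eq_real_def less_le_trans)
  qed
  then obtain e where e: "e > 0" "\<And>s. s > 0 \<Longrightarrow> s < e \<Longrightarrow> f (m + s) \<le> f T / 2"
    by blast
  define s where "s = min (e / 2) (T - m)"
  have "s > 0" "s < e" "m + s \<le> T"
    using e(1) mT by (auto simp: s_def min_def)
  then have "m + s \<in> S"
    using e(2) mT(1) by (simp add: S_def)
  with m(2) \<open>s > 0\<close> show False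
    by fastforce
qed

text \<open>The bound on \<open>t\<close> keeps the whole segment within \<open>\<delta>\<close> of
  \<open>y\<close>, so the distance decreases to the right at each of its points outside
  \<open>A\<close>, while it starts at zero.\<close>

lemma ray_stays_in_set:
  fixes A :: "'a::euclidean_space set"
  assumes A: "closed A"
    and neg: "\<And>w p. dist w y < \<delta> \<Longrightarrow> w \<noteq> p \<Longrightarrow> p \<in> A \<Longrightarrow> dist w p = infdist w A
               \<Longrightarrow> sgn (w - p) \<bullet> u < 0"
    and x: "x \<in> A" and t: "t \<ge> 0" "dist x y + t * norm u < \<delta>"
  shows "x + t *\<^sub>R u \<in> A"
proof -
  have "infdist (x + t *\<^sub>R u) A = 0"
  proof (rule continuous_right_decreasing_eq_0[where f = "\<lambda>s. infdist (x + s *\<^sub>R u) A"])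
    show "continuous_on UNIV (\<lambda>s. infdist (x + s *\<^sub>R u) A)"
      by (intro continuous_intros)
    fix s assume s: "0 \<le> s" "s < t" "0 < infdist (x + s *\<^sub>R u) A"
    define w where "w = x + s *\<^sub>R u"
    have "dist w y \<le> dist x y + s * norm u"
      using norm_triangle_ineq[of "x - y" "s *\<^sub>R u"] s(1) by (simp add: w_def dist_norm algebra_simps)
    also have "\<dots> \<le> dist x y + t * norm u"
      using s by (simp add: mult_right_mono)
    finally have "dist w y < \<delta>"
      using t(2) by simp
    moreover obtain p where "p \<in> A" "infdist w A = dist w p"
      using infdist_attains_inf[OF A] x by (metis empty_iff)
    moreover from this s(3) have "w \<noteq> p"
      by (auto simp: w_def)
    ultimately have "\<exists>e>0. \<forall>s>0. s < e \<longrightarrow> infdist (w + s *\<^sub>R u) A < infdist w A"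
      using neg by (intro nearest_direction_decrease[of w p]) auto
    then show "\<exists>e>0. \<forall>s'>0. s' < e \<longrightarrow> infdist (x + (s + s') *\<^sub>R u) A < infdist (x + s *\<^sub>R u) A"
      by (simp add: w_def algebra_simps)
  qed (use x t in \<open>auto simp: infdist_nonneg\<close>)
  then show ?thesis
    using in_closed_iff_infdist_zero[OF A] x by auto
qed

section \<open>Interior of the tangent cone\<close>

lemma hybrid_subdiff_neg_imp_tangent:
  fixes A :: "(real^'n) set"
  assumes A: "closed A" and y: "y \<in> A"
    and neg: "\<And>\<gamma>. \<gamma> \<in> hybrid_subdiff (\<lambda>w. infdist w A) y \<Longrightarrow> norm \<gamma> = 1 \<Longrightarrow> \<gamma> \<bullet> u < 0"
  shows "u \<in> clarke_tangent_cone A y"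
  unfolding clarke_tangent_cone_def
proof (intro CollectI allI impI, elim conjE)
  fix x :: "nat \<Rightarrow> real^'n" and t :: "nat \<Rightarrow> real"
  assume x: "x \<longlonglongrightarrow> y" "\<forall>i. x i \<in> A" and t: "\<forall>i. t i > 0" "t \<longlonglongrightarrow> 0"
  obtain \<delta> where "\<delta> > 0" and \<delta>: "\<And>w p. dist w y < \<delta> \<Longrightarrow> w \<noteq> p \<Longrightarrow> p \<in> A
      \<Longrightarrow> dist w p = infdist w A \<Longrightarrow> sgn (w - p) \<bullet> u < 0"
    using nearest_direction_inner_neg[OF y neg] by metis
  have "(\<lambda>i. dist (x i) y + t i * norm u) \<longlonglongrightarrow> 0"
    using x(1) t(2) by (intro tendsto_add_zero tendsto_mult_left_zero tendsto_dist_iff[THEN iffD1])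
  then have "\<forall>\<^sub>F i in sequentially. dist (x i) y + t i * norm u < \<delta>"
    using \<open>\<delta> > 0\<close> by (rule order_tendstoD)
  then have ev: "\<forall>\<^sub>F i in sequentially. x i + t i *\<^sub>R u \<in> A"
  proof eventually_elim
    case (elim i)
    show ?case
      by (rule ray_stays_in_set[OF A \<delta> _ _ elim]) (use x(2) t(1) in \<open>auto simp: less_imp_le\<close>)
  qed
  \<comment> \<open>The default \<open>x i\<close> keeps the sequence in \<open>A\<close> at the
    finitely many indices where the ray point may lie outside; afterwards the quotient equals
    \<open>u\<close> exactly.\<close>
  define a where "a i = (if x i + t i *\<^sub>R u \<in> A then x i + t i *\<^sub>R u else x i)" for i
  have "\<forall>\<^sub>F i in sequentially. inverse (t i) *\<^sub>R (a i - x i) = u"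
    using ev
  proof eventually_elim
    case (elim i)
    moreover have "t i \<noteq> 0"
      using t(1) by (metis less_irrefl)
    ultimately show ?case
      by (simp add: a_def)
  qed
  then have "(\<lambda>i. inverse (t i) *\<^sub>R (a i - x i)) \<longlonglongrightarrow> u"
    by (rule tendsto_eventually)
  moreover have "\<forall>i. a i \<in> A"
    using x(2) by (simp add: a_def)
  ultimately show "\<exists>a. (\<forall>i. a i \<in> A) \<and> (\<lambda>i. inverse (t i) *\<^sub>R (a i - x i)) \<longlonglongrightarrow> u"
    by blast
qed

theorem proposition3p4:
  fixes A :: "(real^'n) set" and y :: "real^'n"
  assumes "closed A"
    and "y \<in> frontier A"
    and "\<exists>c>0. \<forall>\<gamma>\<^sub>1 \<in> hybrid_subdiff (\<lambda>x. infdist x A) y.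
                 \<forall>\<gamma>\<^sub>2 \<in> hybrid_subdiff (\<lambda>x. infdist x A) y. \<gamma>\<^sub>1 \<bullet> \<gamma>\<^sub>2 > c"
  shows "interior (clarke_tangent_cone A y) \<noteq> {}"
proof -
  define D where "D = hybrid_subdiff (\<lambda>x. infdist x A) y"
  obtain c where c: "c > 0" "\<And>\<gamma>\<^sub>1 \<gamma>\<^sub>2. \<gamma>\<^sub>1 \<in> D \<Longrightarrow> \<gamma>\<^sub>2 \<in> D \<Longrightarrow> \<gamma>\<^sub>1 \<bullet> \<gamma>\<^sub>2 > c"
    using assms(3) unfolding D_def by blast
  obtain \<gamma>\<^sub>0 where g0: "\<gamma>\<^sub>0 \<in> D"
    using hybrid_subdiff_infdist_nonempty[OF assms(1,2)] by (auto simp: D_def)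
  have yA: "y \<in> A"
    using assms(1,2) by (simp add: frontier_def)
  \<comment> \<open>The radius \<open>c\<close> works because, for a unit vector
    \<open>\<gamma>\<close>, Cauchy-Schwarz gives
    \<open>\<gamma> \<bullet> (u + \<gamma>\<^sub>0) < c\<close>, while
    \<open>\<gamma> \<bullet> \<gamma>\<^sub>0 > c\<close>.\<close>
  have "ball (- \<gamma>\<^sub>0) c \<subseteq> clarke_tangent_cone A y"
  proof
    fix u assume "u \<in> ball (- \<gamma>\<^sub>0) c"
    then have u: "norm (u + \<gamma>\<^sub>0) < c"
      by (simp add: dist_norm norm_minus_commute)
    show "u \<in> clarke_tangent_cone A y"
    proof (rule hybrid_subdiff_neg_imp_tangent[OF assms(1) yA])
      fix \<gamma> assume "\<gamma> \<in> hybrid_subdiff (\<lambda>w. infdist w A) y" "norm \<gamma> = 1"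
      then have "\<gamma> \<bullet> \<gamma>\<^sub>0 > c" "\<gamma> \<bullet> (u + \<gamma>\<^sub>0) < c"
        using c(2)[OF _ g0] norm_cauchy_schwarz[of \<gamma> "u + \<gamma>\<^sub>0"] u by (simp_all add: D_def)
      then show "\<gamma> \<bullet> u < 0"
        by (simp add: inner_add_right)
    qed
  qed
  then show ?thesis
    using c(1) by (metis centre_in_ball empty_iff interior_maximal open_ball subsetD)
qed

end
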